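(* $\mathcal A_2=\mathcal B_2$.
   Context: Let $M=\mathbb R^3$ with coordinates $(x,y,z)$, $X_1=\frac{\partial}{\partial x}$, $X_2=\frac{\partial}{\partial y}+\frac{x^2}{2}\frac{\partial}{\partial z}$, $U_2=\{(u_1,u_2)\in\mathbb R^2: u_1\ge|u_2|\}$, $q_0=(0,0,0)$. The set $\mathcal A_2$ is the attainable set from $q_0$ for arbitrary nonnegative time: the set of all endpoints $q(t_1)$, $t_1\ge0$, of Lipschitz curves $q:[0,t_1]\to M$ with $q(0)=q_0$ satisfying $\dot q=u_1X_1(q)+u_2X_2(q)$ a.e. for some bounded measurable control $u:[0,t_1]\to U_2$. The set $\mathcal B_2$ is $$\mathcal B_2=\{(x,y,z)\in M:\ x\ge|y|,\ z^1(x,y)\le z\le z^2(x,y)\},$$ where $z^1(x,y)=\frac{(x+y)^3-4x^3}{24}$ and $z^2(x,y)=\frac{4x^3-(x-y)^3}{24}$. *)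

theory Defs
  imports "HOL-Analysis.Analysis"
begin

type_synonym point = "real \<times> real \<times> real"

definition X1 :: "point \<Rightarrow> point" where
  "X1 = (\<lambda>(x, y, z). (1, 0, 0))"

definition X2 :: "point \<Rightarrow> point" where
  "X2 = (\<lambda>(x, y, z). (0, 1, x\<^sup>2 / 2))"

definition U2 :: "(real \<times> real) set" where
  "U2 = {(u1, u2). u1 \<ge> \<bar>u2\<bar>}"

definition q0 :: point where
  "q0 = (0, 0, 0)"

definition admissible_control :: "real \<Rightarrow> (real \<Rightarrow> real \<times> real) \<Rightarrow> bool" where
  "admissible_control t1 u \<longleftrightarrow>
     u \<in> borel_measurable (lebesgue_on {0..t1}) \<and>
     bounded (u ` {0..t1}) \<and>
     (\<forall>t\<in>{0..t1}. u t \<in> U2)"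

text \<open>Only the restrictions of \<open>q\<close> and \<open>u\<close> to \<open>{0..t1}\<close> matter below.\<close>

definition trajectory :: "real \<Rightarrow> (real \<Rightarrow> real \<times> real) \<Rightarrow> (real \<Rightarrow> point) \<Rightarrow> bool" where
  "trajectory t1 u q \<longleftrightarrow>
     (\<exists>L. L-lipschitz_on {0..t1} q) \<and>
     (AE t in lebesgue_on {0..t1}.
        (q has_vector_derivative
           (fst (u t) *\<^sub>R X1 (q t) + snd (u t) *\<^sub>R X2 (q t))) (at t within {0..t1}))"

definition A2 :: "point set" where
  "A2 = {q t1 | t1 q u. t1 \<ge> 0 \<and> q 0 = q0 \<and> admissible_control t1 u \<and> trajectory t1 u q}"

definition z1 :: "real \<Rightarrow> real \<Rightarrow> real" where
  "z1 x y = ((x + y) ^ 3 - 4 * x ^ 3) / 24"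

definition z2 :: "real \<Rightarrow> real \<Rightarrow> real" where
  "z2 x y = (4 * x ^ 3 - (x - y) ^ 3) / 24"

definition B2 :: "point set" where
  "B2 = {(x, y, z). x \<ge> \<bar>y\<bar> \<and> z1 x y \<le> z \<and> z \<le> z2 x y}"

end

theory Submission imports Defs begin

text \<open>
  Write \<open>v\<close>, \<open>w\<close> for the controls \<open>u\<^sub>1\<close>, \<open>u\<^sub>2\<close>, so that a trajectory satisfies
  \<open>x' = v\<close>, \<open>y' = w\<close>, \<open>z' = w * x\<^sup>2 / 2\<close> almost everywhere, with \<open>v \<ge> \<bar>w\<bar>\<close>.

  \<^emph>\<open>Attainable points satisfy the bounds.\<close>  The functions \<open>x + y\<close> and \<open>x - y\<close> have derivatives
  \<open>v + w \<ge> 0\<close> and \<open>v - w \<ge> 0\<close>, so \<open>x \<ge> \<bar>y\<bar>\<close> at all times.  The gap to the lower surface then has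
  derivative
  \<open>(z - z1 x y)' = (v + w) * (x - y) * (3 * x + y) / 8 \<ge> 0\<close>.
  The reflection \<open>(x, y, z) \<mapsto> (x, - y, - z)\<close> preserves the system and exchanges the two
  surfaces, which gives the upper bound (\<open>cone_control_lower_bound\<close>, applied to both curves).  Since
  derivatives exist only almost everywhere, the passage from the sign of the derivative to
  monotonicity relies on \<open>mono_on_if_Lipschitz_AE_deriv_nonneg\<close>.

  \<^emph>\<open>Points within the bounds are attainable.\<close>  Take \<open>v = 1\<close>, so that \<open>x\<close> is the time.  Then \<open>y\<close>
  and \<open>z\<close> depend linearly on the control \<open>w\<close>.  For a given endpoint \<open>(x, y)\<close> there are two
  bang-bang controls with one switch that lead there: \<open>w = -1\<close> and then \<open>w = 1\<close> ends on the
  surface \<open>z2\<close>, because the weight \<open>t\<^sup>2 / 2\<close> grows with time; the opposite order ends on \<open>z1\<close>.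
  A convex combination of the two controls takes values in \<open>[-1, 1]\<close>, ends at the same
  \<open>(x, y)\<close>, and reaches any prescribed height in between.
\<close>

section \<open>Lipschitz functions with almost everywhere nonnegative derivative\<close>

text \<open>
  If \<open>f t < f s\<close> for some \<open>s < t\<close>, then \<open>g = f + \<epsilon> * id\<close> still satisfies \<open>g t < g s\<close> for small
  \<open>\<epsilon>\<close>, while its derivative is positive off a null set \<open>N\<close>.  As \<open>g\<close> is Lipschitz, the image
  of \<open>N\<close> under \<open>g\<close> is null, so some value \<open>c\<close> between \<open>g t\<close> and \<open>g s\<close> is attained only off
  \<open>N\<close>.  At the last point before \<open>t\<close> where \<open>g \<ge> c\<close> the value is exactly \<open>c\<close>, so \<open>g\<close> has a
  positive derivative there and exceeds \<open>c\<close> immediately afterwards, which is absurd.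
\<close>

lemma mono_on_if_Lipschitz_AE_deriv_nonneg:
  fixes f :: "real \<Rightarrow> real"
  assumes lip: "L-lipschitz_on {a..b} f"
    and der: "AE t in lebesgue_on {a..b}. \<exists>d\<ge>0. (f has_real_derivative d) (at t within {a..b})"
  shows "mono_on {a..b} f"
proof (rule mono_onI, rule ccontr)
  fix s t assume s: "s \<in> {a..b}" and t: "t \<in> {a..b}" and "s \<le> t" and "\<not> f s \<le> f t"
  then have st: "s < t" and less: "f t < f s"
    using order_le_less by auto
  obtain N where N: "\<And>r. r \<in> {a..b} - N \<Longrightarrow>
      \<exists>d\<ge>0. (f has_real_derivative d) (at r within {a..b})"
    and "N \<in> null_sets (lebesgue_on {a..b})"
    using AE_E3[OF der] by (auto simp: space_restrict_space)
  then have negN: "negligible N" and Nab: "N \<subseteq> {a..b}"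
    by (auto simp: null_sets_restrict_space negligible_iff_null_sets)
  define \<epsilon> where "\<epsilon> = (f s - f t) / (2 * (t - s))"
  define g where "g = (\<lambda>r. f r + \<epsilon> * r)"
  have \<epsilon>: "\<epsilon> > 0"
    using st less by (simp add: \<epsilon>_def)
  have "\<epsilon> * (t - s) = (f s - f t) / 2"
    using st by (auto simp: \<epsilon>_def divide_simps)
  then have gts: "g t < g s"
    using less by (simp add: g_def algebra_simps)
  have lipg: "(L + \<bar>\<epsilon>\<bar> * 1)-lipschitz_on {a..b} g"
    unfolding g_def by (intro lipschitz_intros lip)
  have contg: "continuous_on {a..b} g"
    using lipschitz_on_continuous_on[OF lipg] .
  have "negligible (g ` N)"
  proof (rule negligible_locally_Lipschitz_image)
    fix r assume "r \<in> N"
    then show "\<exists>T B. open T \<and> r \<in> T \<and> (\<forall>y\<in>N \<inter> T. norm (g y - g r) \<le> B * norm (y - r))"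
      using Nab by (intro exI[of _ UNIV] exI[of _ "L + \<bar>\<epsilon>\<bar> * 1"])
        (auto intro!: lipschitz_on_normD[OF lipg, simplified])
  qed (use negN in auto)
  moreover have "\<not> negligible {g t<..<g s}"
    using gts negligible_interval(2)[of "g t" "g s"] by (simp add: box_real)
  ultimately obtain c where c: "g t < c" "c < g s" "c \<notin> g ` N"
    by (metis greaterThanLessThan_iff negligible_subset subsetI)
  define K where "K = {s..t} \<inter> g -` {c..}"
  have conts: "continuous_on {s..t} g"
    using contg s t by (auto intro: continuous_on_subset)
  have "closed K"
    unfolding K_def by (rule continuous_closed_preimage[OF conts]) auto
  then have "compact K"
    using compact_Int_closed[of "{s..t}" K] by (simp add: K_def Int_absorb2)
  moreover have "s \<in> K"
    using st c by (simp add: K_def)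
  ultimately obtain p where pK: "p \<in> K" and last: "\<And>r. r \<in> K \<Longrightarrow> r \<le> p"
    using compact_attains_sup[of K] by blast
  have p: "s \<le> p" "p \<le> t" "c \<le> g p"
    using pK by (auto simp: K_def)
  obtain r where r: "p \<le> r" "r \<le> t" "g r = c"
    using IVT2'[of g t c p] p c continuous_on_subset[OF conts, of "{p..t}"] by auto
  have "r \<in> K"
    using r p by (simp add: K_def)
  then have "p = r"
    using last[of r] r by simp
  then have gp: "g p = c"
    using r by simp
  have "p \<in> {a..b} - N"
    using c(3) gp p s t by auto
  then obtain d where d: "d \<ge> 0" "(f has_real_derivative d) (at p within {a..b})"
    using N by blast
  have "(g has_real_derivative d + \<epsilon>) (at p within {a..b})"
    unfolding g_def using d(2) by (auto intro!: derivative_eq_intros)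
  moreover have "0 < d + \<epsilon>"
    using d(1) \<epsilon> by simp
  ultimately obtain \<delta> where \<delta>: "\<delta> > 0"
    and incr: "\<And>h. h > 0 \<Longrightarrow> p + h \<in> {a..b} \<Longrightarrow> h < \<delta> \<Longrightarrow> g p < g (p + h)"
    using has_real_derivative_pos_inc_right by blast
  have "p < t"
    using gp c(1) p(2) by (cases "p = t") auto
  define h where "h = min (\<delta> / 2) (t - p)"
  have h: "h > 0" "h < \<delta>" "p + h \<le> t"
    using \<delta> \<open>p < t\<close> by (auto simp: h_def min_def)
  have "g p < g (p + h)"
    using incr[of h] h p s t by auto
  then have "p + h \<in> K"
    using h p gp by (simp add: K_def)
  then show False
    using last[of "p + h"] h by simp
qed

lemma ex_lipschitz_on_mult:
  fixes f g :: "'a::metric_space \<Rightarrow> real"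
  assumes "compact S" "\<exists>L. L-lipschitz_on S f" "\<exists>L. L-lipschitz_on S g"
  shows "\<exists>L. L-lipschitz_on S (\<lambda>x. f x * g x)"
proof -
  obtain L M where f: "L-lipschitz_on S f" and g: "M-lipschitz_on S g"
    using assms by blast
  have "bounded (f ` S)" "bounded (g ` S)"
    using f g assms(1)
    by (auto intro!: compact_imp_bounded compact_continuous_image lipschitz_on_continuous_on)
  then obtain B C where B: "\<And>x. x \<in> S \<Longrightarrow> \<bar>f x\<bar> \<le> B" "B > 0"
    and C: "\<And>x. x \<in> S \<Longrightarrow> \<bar>g x\<bar> \<le> C" "C > 0"
    unfolding bounded_pos by auto
  have "(B * M + C * L)-lipschitz_on S (\<lambda>x. f x * g x)"
  proof (rule lipschitz_onI)
    fix x y assume xy: "x \<in> S" "y \<in> S"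
    have "f x * g x - f y * g y = f x * (g x - g y) + g y * (f x - f y)"
      by (simp add: algebra_simps)
    then have "dist (f x * g x) (f y * g y) \<le> \<bar>f x\<bar> * \<bar>g x - g y\<bar> + \<bar>g y\<bar> * \<bar>f x - f y\<bar>"
      using abs_triangle_ineq[of "f x * (g x - g y)" "g y * (f x - f y)"]
      by (simp add: dist_real_def abs_mult)
    also have "\<dots> \<le> B * (M * dist x y) + C * (L * dist x y)"
      using lipschitz_onD[OF f xy] lipschitz_onD[OF g xy] B C xy
      by (intro add_mono mult_mono) (auto simp: dist_real_def less_imp_le)
    finally show "dist (f x * g x) (f y * g y) \<le> (B * M + C * L) * dist x y"
      by (simp add: algebra_simps)
  qed (use B C lipschitz_on_nonneg[OF f] lipschitz_on_nonneg[OF g] in auto)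
  then show ?thesis by blast
qed

lemma ex_lipschitz_on_power:
  fixes f :: "'a::metric_space \<Rightarrow> real"
  assumes "compact S" "\<exists>L. L-lipschitz_on S f"
  shows "\<exists>L. L-lipschitz_on S (\<lambda>x. f x ^ n)"
proof (induction n)
  case 0
  then show ?case using lipschitz_on_constant by auto
next
  case (Suc n)
  then show ?case using ex_lipschitz_on_mult[OF assms Suc] by simp
qed

lemma ex_lipschitz_on_abs:
  fixes f :: "'a::metric_space \<Rightarrow> real"
  assumes "\<exists>L. L-lipschitz_on S f"
  shows "\<exists>L. L-lipschitz_on S (\<lambda>x. \<bar>f x\<bar>)"
proof -
  obtain L where L: "L-lipschitz_on S f" using assms by blast
  have "L-lipschitz_on S (\<lambda>x. \<bar>f x\<bar>)"
  proof (rule lipschitz_onI)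
    fix x y assume "x \<in> S" "y \<in> S"
    then have "\<bar>f x - f y\<bar> \<le> L * dist x y"
      using lipschitz_onD[OF L] by (simp add: dist_real_def)
    then show "dist \<bar>f x\<bar> \<bar>f y\<bar> \<le> L * dist x y"
      by (simp add: dist_real_def)
  qed (rule lipschitz_on_nonneg[OF L])
  then show ?thesis by blast
qed

section \<open>Attainable points satisfy the bounds\<close>

text \<open>
  The pair \<open>(v, w)\<close> is the control in coordinates.  The bound \<open>\<bar>y\<bar> \<le> x\<close> has to be known at all times
  before \<open>T\<close>, since it determines the sign of the factors \<open>x - y\<close> and \<open>3 * x + y\<close> in the
  derivative of \<open>z - z1 x y\<close>.
\<close>

lemma cone_control_lower_bound:
  fixes x y z v w :: "real \<Rightarrow> real"
  assumes T: "0 \<le> T"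
    and init: "x 0 = 0" "y 0 = 0" "z 0 = 0"
    and lip: "\<exists>L. L-lipschitz_on {0..T} x" "\<exists>L. L-lipschitz_on {0..T} y"
      "\<exists>L. L-lipschitz_on {0..T} z"
    and cone: "\<And>t. t \<in> {0..T} \<Longrightarrow> \<bar>w t\<bar> \<le> v t"
    and ode: "AE t in lebesgue_on {0..T}.
      (x has_real_derivative v t) (at t within {0..T}) \<and>
      (y has_real_derivative w t) (at t within {0..T}) \<and>
      (z has_real_derivative w t * (x t)\<^sup>2 / 2) (at t within {0..T})"
  shows "\<bar>y T\<bar> \<le> x T \<and> z1 (x T) (y T) \<le> z T"
proof -
  obtain Lx Ly Lz where L: "Lx-lipschitz_on {0..T} x" "Ly-lipschitz_on {0..T} y"
    "Lz-lipschitz_on {0..T} z"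
    using lip by blast
  have incr: "f 0 \<le> f t"
    if "\<exists>L. L-lipschitz_on {0..T} f" "t \<in> {0..T}"
      and "\<And>t. t \<in> {0..T} \<Longrightarrow> (x has_real_derivative v t) (at t within {0..T}) \<Longrightarrow>
        (y has_real_derivative w t) (at t within {0..T}) \<Longrightarrow>
        (z has_real_derivative w t * (x t)\<^sup>2 / 2) (at t within {0..T}) \<Longrightarrow>
        \<exists>d\<ge>0. (f has_real_derivative d) (at t within {0..T})"
    for f t
  proof -
    have "AE t in lebesgue_on {0..T}. \<exists>d\<ge>0. (f has_real_derivative d) (at t within {0..T})"
      using ode by (rule AE_mp) (auto intro!: AE_I2 that(3) simp: space_restrict_space)
    then have "mono_on {0..T} f"
      using that(1) mono_on_if_Lipschitz_AE_deriv_nonneg by blast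
    then show ?thesis
      using that(2) T by (auto intro: mono_onD)
  qed
  have cone_xy: "\<bar>y t\<bar> \<le> x t" if t: "t \<in> {0..T}" for t
  proof -
    have "x 0 + y 0 \<le> x t + y t"
    proof (rule incr[OF _ t])
      show "\<exists>L. L-lipschitz_on {0..T} (\<lambda>t. x t + y t)"
        using L by (blast intro: lipschitz_on_add)
      show "\<exists>d\<ge>0. ((\<lambda>t. x t + y t) has_real_derivative d) (at t within {0..T})"
        if "t \<in> {0..T}" "(x has_real_derivative v t) (at t within {0..T})"
          "(y has_real_derivative w t) (at t within {0..T})" for t
        using cone[OF that(1)] that by (intro exI[of _ "v t + w t"]) (auto intro: DERIV_add)
    qed
    moreover have "x 0 - y 0 \<le> x t - y t"
    proof (rule incr[OF _ t])
      show "\<exists>L. L-lipschitz_on {0..T} (\<lambda>t. x t - y t)"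
        using L by (blast intro: lipschitz_on_diff)
      show "\<exists>d\<ge>0. ((\<lambda>t. x t - y t) has_real_derivative d) (at t within {0..T})"
        if "t \<in> {0..T}" "(x has_real_derivative v t) (at t within {0..T})"
          "(y has_real_derivative w t) (at t within {0..T})" for t
        using cone[OF that(1)] that by (intro exI[of _ "v t - w t"]) (auto intro: DERIV_diff)
    qed
    ultimately show ?thesis
      using init by simp
  qed
  have "z 0 - z1 (x 0) (y 0) \<le> z T - z1 (x T) (y T)"
  proof (rule incr[where f = "\<lambda>t. z t - z1 (x t) (y t)"])
    have "\<exists>L. L-lipschitz_on {0..T} (\<lambda>t. x t + y t)"
      using L by (blast intro: lipschitz_on_add)
    then obtain L1 L2 where "L1-lipschitz_on {0..T} (\<lambda>t. (x t + y t) ^ 3)"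
      "L2-lipschitz_on {0..T} (\<lambda>t. x t ^ 3)"
      using ex_lipschitz_on_power[of "{0..T}"] lip(1) by (metis compact_Icc)
    then have "(Lz + \<bar>1 / 24\<bar> * (L1 + \<bar>4\<bar> * L2))-lipschitz_on {0..T}
        (\<lambda>t. z t - 1 / 24 * ((x t + y t) ^ 3 - 4 * x t ^ 3))"
      by (intro lipschitz_intros L)
    then show "\<exists>L. L-lipschitz_on {0..T} (\<lambda>t. z t - z1 (x t) (y t))"
      by (auto simp: z1_def)
    fix t assume t: "t \<in> {0..T}"
      and d: "(x has_real_derivative v t) (at t within {0..T})"
        "(y has_real_derivative w t) (at t within {0..T})"
        "(z has_real_derivative w t * (x t)\<^sup>2 / 2) (at t within {0..T})"
    have "((\<lambda>t. z t - z1 (x t) (y t)) has_real_derivative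
        (v t + w t) * (x t - y t) * (3 * x t + y t) / 8) (at t within {0..T})"
      unfolding z1_def
      by (auto intro!: derivative_eq_intros d simp: field_simps power2_eq_square)
    moreover have "(v t + w t) * (x t - y t) * (3 * x t + y t) / 8 \<ge> 0"
      using cone[OF t] cone_xy[OF t] by (intro divide_nonneg_nonneg mult_nonneg_nonneg) auto
    ultimately show "\<exists>d\<ge>0. ((\<lambda>t. z t - z1 (x t) (y t)) has_real_derivative d) (at t within {0..T})"
      by blast
  qed (use T in auto)
  then show ?thesis
    using cone_xy[of T] T init by (simp add: z1_def)
qed

lemma z2_eq_reflected_z1: "z2 x y = - z1 x (- y)"
  by (simp add: z1_def z2_def minus_divide_left)

lemma A2_subset_B2: "A2 \<subseteq> B2"
proof
  fix p assume "p \<in> A2"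
  then obtain T q u where p: "p = q T" and T: "0 \<le> T" and q0: "q 0 = q0"
    and u: "admissible_control T u" and traj: "trajectory T u q"
    by (auto simp: A2_def)
  define x y z where "x = (\<lambda>t. fst (q t))" and "y = (\<lambda>t. fst (snd (q t)))"
    and "z = (\<lambda>t. snd (snd (q t)))"
  note xyz = x_def y_def z_def
  obtain L where L: "L-lipschitz_on {0..T} q"
    using traj by (auto simp: trajectory_def)
  have coord: "L-lipschitz_on {0..T} x" "L-lipschitz_on {0..T} y" "L-lipschitz_on {0..T} z"
  proof -
    have *: "L-lipschitz_on {0..T} (\<lambda>t. fst (f t))" "L-lipschitz_on {0..T} (\<lambda>t. snd (f t))"
      if "L-lipschitz_on {0..T} f" for f :: "real \<Rightarrow> 'a::metric_space \<times> 'b::metric_space"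
      using that unfolding lipschitz_on_def
      by (meson dist_fst_le dist_snd_le order_trans)+
    show "L-lipschitz_on {0..T} x" "L-lipschitz_on {0..T} y" "L-lipschitz_on {0..T} z"
      unfolding xyz by (rule *(1)[OF L] *(1)[OF *(2)[OF L]] *(2)[OF *(2)[OF L]])+
  qed
  have cone: "\<bar>snd (u t)\<bar> \<le> fst (u t)" if "t \<in> {0..T}" for t
    using u that by (force simp: admissible_control_def U2_def)
  have ode: "AE t in lebesgue_on {0..T}.
      (x has_real_derivative fst (u t)) (at t within {0..T}) \<and>
      (y has_real_derivative snd (u t)) (at t within {0..T}) \<and>
      (z has_real_derivative snd (u t) * (x t)\<^sup>2 / 2) (at t within {0..T})"
  proof -
    have "AE t in lebesgue_on {0..T}.
        (q has_vector_derivative (fst (u t) *\<^sub>R X1 (q t) + snd (u t) *\<^sub>R X2 (q t)))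
          (at t within {0..T})"
      using traj by (simp add: trajectory_def)
    then show ?thesis
    proof (rule AE_mp, intro AE_I2 impI conjI)
      fix t assume d: "(q has_vector_derivative (fst (u t) *\<^sub>R X1 (q t) + snd (u t) *\<^sub>R X2 (q t)))
          (at t within {0..T})"
      have rhs: "fst (u t) *\<^sub>R X1 (q t) + snd (u t) *\<^sub>R X2 (q t) =
          (fst (u t), snd (u t), snd (u t) * (x t)\<^sup>2 / 2)"
        by (simp add: X1_def X2_def x_def split_beta)
      note d' = bounded_linear.has_vector_derivative[OF _ d[unfolded rhs]]
      show "(x has_real_derivative fst (u t)) (at t within {0..T})"
        using d'[OF bounded_linear_fst]
        by (simp add: x_def has_real_derivative_iff_has_vector_derivative)
      show "(y has_real_derivative snd (u t)) (at t within {0..T})"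
        using d'[OF bounded_linear_fst_comp[OF bounded_linear_snd]]
        by (simp add: y_def has_real_derivative_iff_has_vector_derivative)
      show "(z has_real_derivative snd (u t) * (x t)\<^sup>2 / 2) (at t within {0..T})"
        using d'[OF bounded_linear_snd_comp[OF bounded_linear_snd]]
        by (simp add: z_def has_real_derivative_iff_has_vector_derivative)
    qed
  qed
  have init: "x 0 = 0" "y 0 = 0" "z 0 = 0"
    using q0 by (simp_all add: xyz q0_def)
  have lower: "\<bar>y T\<bar> \<le> x T \<and> z1 (x T) (y T) \<le> z T"
    by (rule cone_control_lower_bound[OF T init _ _ _ cone ode]) (use coord in blast)+
  \<comment> \<open>The reflected curve \<open>(x, - y, - z)\<close> is driven by the control \<open>(u\<^sub>1, - u\<^sub>2)\<close>.\<close>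
  have "\<bar>- y T\<bar> \<le> x T \<and> z1 (x T) (- y T) \<le> - z T"
  proof (rule cone_control_lower_bound[OF T, of x "\<lambda>t. - y t" "\<lambda>t. - z t"])
    show "AE t in lebesgue_on {0..T}.
      (x has_real_derivative fst (u t)) (at t within {0..T}) \<and>
      ((\<lambda>t. - y t) has_real_derivative - snd (u t)) (at t within {0..T}) \<and>
      ((\<lambda>t. - z t) has_real_derivative - snd (u t) * (x t)\<^sup>2 / 2) (at t within {0..T})"
      using ode by (rule AE_mp) (auto intro!: AE_I2 dest: DERIV_minus)
  qed (use coord init cone in auto)
  then have "z T \<le> z2 (x T) (y T)"
    by (simp add: z2_eq_reflected_z1)
  then have "(x T, y T, z T) \<in> B2"
    using lower by (simp add: B2_def)
  then show "p \<in> B2"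
    by (simp add: p xyz)
qed

section \<open>Points within the bounds are attainable\<close>

lemma has_real_derivative_abs_sgn:
  fixes f :: "real \<Rightarrow> real"
  assumes "(f has_real_derivative d) (at t within S)" "f t \<noteq> 0"
  shows "((\<lambda>t. \<bar>f t\<bar>) has_real_derivative sgn (f t) * d) (at t within S)"
proof -
  have "(abs has_real_derivative sgn (f t)) (at (f t))"
    using GDERIV_norm[OF assms(2)]
    by (simp add: gderiv_def has_field_derivative_def mult.commute)
  then show ?thesis
    using assms(1) by (rule DERIV_chain2)
qed

lemma sgn_cube_diff: "sgn (t ^ 3 - a ^ 3) = sgn (t - a)" for a t :: real
proof -
  have "t ^ 3 < a ^ 3 \<longleftrightarrow> t < a" "a ^ 3 < t ^ 3 \<longleftrightarrow> a < t"
    using real_root_less_iff[of 3 "t ^ 3" "a ^ 3"] real_root_less_iff[of 3 "a ^ 3" "t ^ 3"]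
    by (simp_all add: odd_real_root_power_cancel)
  then show ?thesis
    by (auto simp: sgn_if)
qed

text \<open>
  The curve is given in closed form: for \<open>a \<ge> 0\<close> and \<open>t \<ge> 0\<close>, integration from \<open>0\<close> to \<open>t\<close> takes
  \<open>sgn (t - a)\<close> to \<open>\<bar>t - a\<bar> - a\<close>, and \<open>sgn (t - a) * t\<^sup>2 / 2\<close> to \<open>(\<bar>t ^ 3 - a ^ 3\<bar> - a ^ 3) / 6\<close>.
  The two absolute values fail to be differentiable at most at \<open>t = a\<close>, so that the differential
  equation holds off the two switching times.
\<close>

lemma B2_subset_A2: "B2 \<subseteq> A2"
proof
  fix p assume "p \<in> B2"
  then obtain x y z where p: "p = (x, y, z)" and xy: "\<bar>y\<bar> \<le> x"
    and z: "z1 x y \<le> z" "z \<le> z2 x y"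
    by (auto simp: B2_def)
  have "z \<in> closed_segment (z1 x y) (z2 x y)"
    using z by (auto simp: closed_segment_eq_real_ivl)
  then obtain l where l: "0 \<le> l" "l \<le> 1" and zl: "z = (1 - l) * z1 x y + l * z2 x y"
    by (auto simp: closed_segment_def)
  \<comment> \<open>The switching times: a bang-bang control equal to \<open>-1\<close> on \<open>{0..a}\<close> and then \<open>1\<close>, or to \<open>1\<close>
    on \<open>{0..b}\<close> and then \<open>-1\<close>, has integral \<open>y\<close> over \<open>{0..x}\<close>.\<close>
  define a b where "a = (x - y) / 2" and "b = (x + y) / 2"
  define w where "w = (\<lambda>t. l * sgn (t - a) - (1 - l) * sgn (t - b))"
  define u where "u = (\<lambda>t. (1::real, w t))"
  define Y where "Y = (\<lambda>t. l * (\<bar>t - a\<bar> - a) + (1 - l) * (b - \<bar>t - b\<bar>))"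
  define Z where "Z = (\<lambda>t. l * ((\<bar>t ^ 3 - a ^ 3\<bar> - a ^ 3) / 6)
    + (1 - l) * ((b ^ 3 - \<bar>t ^ 3 - b ^ 3\<bar>) / 6))"
  define q where "q = (\<lambda>t. (t, Y t, Z t))"
  have ab: "0 \<le> a" "0 \<le> b" "a \<le> x" "b \<le> x"
    using xy by (auto simp: a_def b_def)
  have w1: "\<bar>w t\<bar> \<le> 1" for t
  proof -
    have "\<bar>l * sgn (t - a)\<bar> \<le> l" "\<bar>(1 - l) * sgn (t - b)\<bar> \<le> 1 - l"
      using l by (auto simp: sgn_if)
    then show ?thesis
      unfolding w_def by linarith
  qed
  have adm: "admissible_control x u"
    unfolding admissible_control_def
  proof (intro conjI ballI)
    have "w \<in> borel_measurable borel"
      unfolding w_def by measurable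
    then have "u \<in> borel_measurable borel"
      unfolding u_def by measurable
    then show "u \<in> borel_measurable (lebesgue_on {0..x})"
      by (intro measurable_restrict_space1 measurable_completion) simp
    have "u ` {0..x} \<subseteq> {1} \<times> {-1..1}"
      using w1 by (auto simp: u_def abs_le_iff minus_le_iff)
    then show "bounded (u ` {0..x})"
      by (rule bounded_subset[rotated]) (auto intro: bounded_Times)
    show "u t \<in> U2" for t
      using w1[of t] by (simp add: u_def U2_def)
  qed
  have traj: "trajectory x u q"
    unfolding trajectory_def
  proof
    have id: "\<exists>L. L-lipschitz_on {0..x} (\<lambda>t. t)"
      using lipschitz_on_id by blast
    have diff: "\<exists>L. L-lipschitz_on {0..x} (\<lambda>t. f t - c)"
      if "\<exists>L. L-lipschitz_on {0..x} f" for f :: "real \<Rightarrow> real" and c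
      using that lipschitz_on_diff[OF _ lipschitz_on_constant] by blast
    obtain A B C D where
      ABCD: "A-lipschitz_on {0..x} (\<lambda>t. \<bar>t - a\<bar>)" "B-lipschitz_on {0..x} (\<lambda>t. \<bar>t - b\<bar>)"
      "C-lipschitz_on {0..x} (\<lambda>t. \<bar>t ^ 3 - a ^ 3\<bar>)" "D-lipschitz_on {0..x} (\<lambda>t. \<bar>t ^ 3 - b ^ 3\<bar>)"
      using ex_lipschitz_on_abs[OF diff[OF id]]
        ex_lipschitz_on_abs[OF diff[OF ex_lipschitz_on_power[OF compact_Icc id]]] by metis
    have "\<exists>L. L-lipschitz_on {0..x} Y"
      unfolding Y_def
      by (rule exI)
        (rule lipschitz_on_add lipschitz_on_diff lipschitz_on_cmult_real lipschitz_on_constant ABCD)+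
    moreover have "\<exists>L. L-lipschitz_on {0..x} (\<lambda>t. l * (1 / 6 * (\<bar>t ^ 3 - a ^ 3\<bar> - a ^ 3))
        + (1 - l) * (1 / 6 * (b ^ 3 - \<bar>t ^ 3 - b ^ 3\<bar>)))"
      by (rule exI)
        (rule lipschitz_on_add lipschitz_on_diff lipschitz_on_cmult_real lipschitz_on_constant ABCD)+
    then have "\<exists>L. L-lipschitz_on {0..x} Z"
      by (simp add: Z_def)
    ultimately obtain M N where "M-lipschitz_on {0..x} Y" "N-lipschitz_on {0..x} Z"
      by blast
    then show "\<exists>L. L-lipschitz_on {0..x} q"
      unfolding q_def by (intro exI) (rule lipschitz_on_Pair lipschitz_on_id | assumption)+
    have ode: "(q has_vector_derivative (fst (u t) *\<^sub>R X1 (q t) + snd (u t) *\<^sub>R X2 (q t)))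
        (at t within {0..x})" if t: "t \<noteq> a" "t \<noteq> b" for t
    proof -
      have lin: "((\<lambda>t. \<bar>t - c\<bar>) has_real_derivative sgn (t - c)) (at t within {0..x})"
        if "t \<noteq> c" for c
      proof -
        have "((\<lambda>t. t - c) has_real_derivative 1) (at t within {0..x})"
          by (auto intro!: derivative_eq_intros)
        then show ?thesis
          using has_real_derivative_abs_sgn[of "\<lambda>t. t - c" 1] that by fastforce
      qed
      have cub: "((\<lambda>t. \<bar>t ^ 3 - c ^ 3\<bar>) has_real_derivative sgn (t - c) * (3 * t\<^sup>2))
          (at t within {0..x})" if "t \<noteq> c" for c
      proof -
        have "((\<lambda>t. t ^ 3 - c ^ 3) has_real_derivative 3 * t\<^sup>2) (at t within {0..x})"
          by (auto intro!: derivative_eq_intros)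
        moreover have "t ^ 3 - c ^ 3 \<noteq> 0"
          using sgn_cube_diff[of t c] that by (metis right_minus_eq sgn_0_0)
        ultimately show ?thesis
          using has_real_derivative_abs_sgn[of "\<lambda>t. t ^ 3 - c ^ 3"] by (simp add: sgn_cube_diff)
      qed
      have "(Y has_real_derivative w t) (at t within {0..x})"
        unfolding Y_def w_def by (auto intro!: derivative_eq_intros lin t)
      moreover have "(Z has_real_derivative w t * t\<^sup>2 / 2) (at t within {0..x})"
        unfolding Z_def w_def
        by (auto intro!: derivative_eq_intros cub t simp: field_simps)
      ultimately have "(q has_vector_derivative (1, w t, w t * t\<^sup>2 / 2)) (at t within {0..x})"
        unfolding q_def
        by (intro has_vector_derivative_Pair has_vector_derivative_id)
          (simp_all add: has_real_derivative_iff_has_vector_derivative)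
      then show ?thesis
        by (simp add: u_def q_def X1_def X2_def)
    qed
    have "negligible {a, b}"
      by simp
    then have "AE t in lebesgue. t \<notin> {a, b}"
      by (intro AE_not_in) (simp only: negligible_iff_null_sets)
    then have "AE t in lebesgue. t \<in> {0..x} \<longrightarrow>
        (q has_vector_derivative (fst (u t) *\<^sub>R X1 (q t) + snd (u t) *\<^sub>R X2 (q t)))
          (at t within {0..x})"
      by (rule eventually_mono) (use ode in blast)
    then show "AE t in lebesgue_on {0..x}.
        (q has_vector_derivative (fst (u t) *\<^sub>R X1 (q t) + snd (u t) *\<^sub>R X2 (q t)))
          (at t within {0..x})"
      by (simp add: AE_restrict_space_iff)
  qed
  have start: "q 0 = q0"
    using ab by (simp add: q_def q0_def Y_def Z_def)
  have "\<bar>x ^ 3 - a ^ 3\<bar> = x ^ 3 - a ^ 3" "\<bar>x ^ 3 - b ^ 3\<bar> = x ^ 3 - b ^ 3"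
    using ab by (auto intro!: abs_of_nonneg power_mono)
  then have "Z x = l * ((x ^ 3 - 2 * a ^ 3) / 6) + (1 - l) * ((2 * b ^ 3 - x ^ 3) / 6)"
    by (simp add: Z_def)
  also have "(x ^ 3 - 2 * a ^ 3) / 6 = z2 x y"
    by (simp add: a_def z2_def power_divide field_simps)
  also have "(2 * b ^ 3 - x ^ 3) / 6 = z1 x y"
    by (simp add: b_def z1_def power_divide field_simps)
  finally have "Z x = z"
    using zl by simp
  have "Y x = l * (x - 2 * a) + (1 - l) * (2 * b - x)"
    using ab by (simp add: Y_def)
  also have "x - 2 * a = y"
    by (simp add: a_def field_simps)
  also have "2 * b - x = y"
    by (simp add: b_def field_simps)
  finally have "Y x = y"
    by (simp add: algebra_simps)
  with \<open>Z x = z\<close> have "q x = p"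
    by (simp add: q_def p)
  moreover have "0 \<le> x"
    using xy by simp
  ultimately show "p \<in> A2"
    unfolding A2_def using start adm traj by blast
qed

theorem theorem10: "A2 = B2"
  using A2_subset_B2 B2_subset_A2 by (rule subset_antisym)

end
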